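(* In the basic Fraenkel model $\mathcal V_{F_0}$, with $A$ its set of atoms, there is no injection from $\mathrm{seq}^{1-1}(A)$ into $\mathrm{Part}_{\mathrm{fin}}(A)$. Consequently (via the Jech–Sochor embedding theorem) it is consistent with ZF that there is an infinite set $X$ with $|\mathrm{seq}^{1-1}(X)|\not\le|\mathrm{Part}_{\mathrm{fin}}(X)|$, so the Dedekind-infiniteness hypothesis in "$|\mathrm{seq}(X)|<|\mathrm{Part}_{\mathrm{fin}}(X)|$ for Dedekind infinite $X$" cannot be removed.
   Context: ZFA is Zermelo–Fraenkel set theory with atoms. The basic Fraenkel model $\mathcal V_{F_0}$ is the permutation model obtained from a denumerable set $A$ of atoms, the group $\mathcal G$ of all permutations of $A$, and the normal ideal of finite subsets of $A$: a finite $E\subseteq A$ is a support of $x$ if every $\pi\in\mathcal G$ fixing $E$ pointwise satisfies $\pi x=x$, and $\mathcal V_{F_0}$ consists of the sets $x$ that have a finite support and all of whose elements are in $\mathcal V_{F_0}$ (hereditarily). $\mathrm{seq}^{1-1}(A)$ is the set of injective finite sequences of elements of $A$; $\mathrm{Part}_{\mathrm{fin}}(A)$ is the set of partitions of $A$ all of whose blocks are finite. *)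

theory Defs
  imports Main
begin

text \<open>Atoms of the basic Fraenkel model: a denumerable set, represented by the type nat.
  The group G is the group of all permutations (bijections) of the atoms; supports are finite sets.\<close>

definition is_partition :: "'a set \<Rightarrow> 'a set set \<Rightarrow> bool" where
  "is_partition X P \<longleftrightarrow> (\<forall>B\<in>P. B \<noteq> {}) \<and> \<Union>P = X \<and>
     (\<forall>B\<in>P. \<forall>C\<in>P. B \<noteq> C \<longrightarrow> B \<inter> C = {})"

definition Part_fin :: "'a set \<Rightarrow> 'a set set set" where
  "Part_fin X = {P. is_partition X P \<and> (\<forall>B\<in>P. finite B)}"

definition seq_inj :: "'a set \<Rightarrow> 'a list set" where
  "seq_inj X = {s. distinct s \<and> set s \<subseteq> X}"

definition fixing_perm :: "'a set \<Rightarrow> ('a \<Rightarrow> 'a) \<Rightarrow> bool" where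
  "fixing_perm E \<pi> \<longleftrightarrow> bij \<pi> \<and> (\<forall>a\<in>E. \<pi> a = a)"

text \<open>A function f : seq^{1-1}(A) -> Part_fin(A) lies in the basic Fraenkel model iff it has a
  finite support E, i.e. every permutation fixing E pointwise commutes with f
  (pi(f) = f, where pi acts on sequences entrywise and on partitions blockwise).\<close>
definition fm_supports :: "nat set \<Rightarrow> (nat list \<Rightarrow> nat set set) \<Rightarrow> bool" where
  "fm_supports E f \<longleftrightarrow> (\<forall>\<pi>. fixing_perm E \<pi> \<longrightarrow>
      (\<forall>s\<in>seq_inj UNIV. f (map \<pi> s) = (\<lambda>B. \<pi> ` B) ` f s))"

end

theory Submission
  imports Defs "HOL-Combinatorics.Transposition"
begin

text \<open>Let f be injective with finite support E, and let s enumerate a set S of 2^|E| + 1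
  atoms outside E. The partition P = f s is fixed by every transposition of atoms outside
  E \<union> S, so, its blocks being finite, each such atom is a singleton block. If two atoms of S
  share a block, their transposition fixes P. Otherwise every block meeting S lies within one
  atom of S together with E; by pigeonhole two atoms of S have the same trace on E, which is
  empty since their blocks are disjoint, so both are singleton blocks and again their
  transposition fixes P. As it also fixes E pointwise, f identifies s with a different
  sequence.\<close>

lemma is_partition_block_eq:
  assumes "is_partition X P" "B \<in> P" "C \<in> P" "x \<in> B" "x \<in> C"
  shows "B = C"
  using assms unfolding is_partition_def by blast

lemma involution_image_eq_if_closed:
  assumes "\<And>x. g (g x) = x" and "\<And>C. C \<in> P \<Longrightarrow> g ` C \<in> P"
  shows "(\<lambda>C. g ` C) ` P = P"
proof
  show "(\<lambda>C. g ` C) ` P \<subseteq> P" using assms(2) by auto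
  show "P \<subseteq> (\<lambda>C. g ` C) ` P"
  proof
    fix C assume "C \<in> P"
    moreover have "C = g ` g ` C" by (simp add: image_image assms(1))
    ultimately show "C \<in> (\<lambda>C. g ` C) ` P" using assms(2) by blast
  qed
qed

lemma partition_transpose_invariant_same_block:
  assumes P: "is_partition X P" and "B \<in> P" "a \<in> B" "b \<in> B"
  shows "(\<lambda>C. transpose a b ` C) ` P = P"
proof -
  have "transpose a b ` C = C" if "C \<in> P" for C
    using is_partition_block_eq[OF P that] assms(2-4) by (intro transpose_image_eq) blast
  then show ?thesis by simp
qed

lemma partition_transpose_invariant_singletons:
  assumes P: "is_partition X P" and a: "{a} \<in> P" and b: "{b} \<in> P"
  shows "(\<lambda>C. transpose a b ` C) ` P = P"
proof (rule involution_image_eq_if_closed)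
  fix C assume C: "C \<in> P"
  consider "a \<in> C" | "b \<in> C" | "a \<notin> C" "b \<notin> C" by blast
  then show "transpose a b ` C \<in> P"
  proof cases
    case 1
    then have "C = {a}" using is_partition_block_eq[OF P C a] by blast
    then show ?thesis using b by simp
  next
    case 2
    then have "C = {b}" using is_partition_block_eq[OF P C b] by blast
    then show ?thesis using a by simp
  qed (use C in simp)
qed simp

text \<open>If B had a second element e, transposing c with a fresh atom d would move B to a
  block that meets B in e but contains d.\<close>

lemma partition_block_singleton_if_transpose_invariant:
  assumes inf: "infinite (UNIV :: 'a set)"
    and P: "is_partition X P" and F: "finite F"
    and inv: "\<And>c d. c \<notin> F \<Longrightarrow> d \<notin> F \<Longrightarrow> (\<lambda>C. transpose c d ` C) ` P = P"
    and B: "B \<in> P" "finite B" and c: "(c :: 'a) \<in> B" "c \<notin> F"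
  shows "B = {c}"
proof (rule ccontr)
  assume "B \<noteq> {c}"
  then obtain e where e: "e \<in> B" "e \<noteq> c" using c by blast
  obtain d where d: "d \<notin> F \<union> B"
    using ex_new_if_finite[OF inf] F B(2) by blast
  have moved: "transpose c d ` B \<in> P" using inv[of c d] c d B by blast
  have "e \<noteq> d" using e d by blast
  then have "e \<in> transpose c d ` B"
    using e by (simp add: in_transpose_image_iff)
  then have "transpose c d ` B = B" using is_partition_block_eq[OF P moved B(1)] e by blast
  moreover have "d \<in> transpose c d ` B" using c by (simp add: in_transpose_image_iff)
  ultimately show False using d by simp
qed

lemma partition_block_subset_insert_if_transpose_invariant:
  assumes inf: "infinite (UNIV :: 'a set)"
    and P: "is_partition X P" and ES: "finite (E \<union> S)"
    and inv: "\<And>c d. c \<notin> E \<union> S \<Longrightarrow> d \<notin> E \<union> S \<Longrightarrow> (\<lambda>C. transpose c d ` C) ` P = P"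
    and B: "B \<in> P" "finite B" "(x :: 'a) \<in> B" "B \<inter> S \<subseteq> {x}"
  shows "B \<subseteq> insert x E"
proof
  fix y assume y: "y \<in> B"
  show "y \<in> insert x E"
  proof (cases "y \<in> E \<union> S")
    case True
    then show ?thesis using y B(4) by blast
  next
    case False
    then have "B = {y}"
      using partition_block_singleton_if_transpose_invariant[OF inf P ES inv B(1,2) y] by blast
    then show ?thesis using B(3) by simp
  qed
qed

lemma partition_transpose_invariant_pigeonhole:
  assumes inf: "infinite (UNIV :: 'a set)"
    and P: "is_partition X P" and fin: "\<forall>B\<in>P. finite B" and E: "finite E"
    and S: "finite S" "S \<subseteq> X" "card S > 2 ^ card E"
    and inv: "\<And>c d. c \<notin> E \<union> S \<Longrightarrow> d \<notin> E \<union> S \<Longrightarrow> (\<lambda>C. transpose c d ` C) ` P = P"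
  shows "\<exists>a\<in>S. \<exists>b\<in>S. a \<noteq> (b :: 'a) \<and> (\<lambda>C. transpose a b ` C) ` P = P"
proof (cases "\<exists>a\<in>S. \<exists>b\<in>S. a \<noteq> b \<and> (\<exists>B\<in>P. a \<in> B \<and> b \<in> B)")
  case True
  then obtain a b B where "a \<in> S" "b \<in> S" "a \<noteq> b" "B \<in> P" "a \<in> B" "b \<in> B" by blast
  then show ?thesis using partition_transpose_invariant_same_block[OF P, of B a b] by blast
next
  case separated: False
  have "\<forall>x\<in>X. \<exists>B. B \<in> P \<and> x \<in> B" using P unfolding is_partition_def by blast
  then obtain blk where blk: "\<And>x. x \<in> X \<Longrightarrow> blk x \<in> P \<and> x \<in> blk x" by metis
  have blk_subset: "blk x \<subseteq> insert x E" if x: "x \<in> S" for x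
  proof (rule partition_block_subset_insert_if_transpose_invariant[OF inf P _ inv])
    show "blk x \<in> P" "x \<in> blk x" using blk[of x] x S(2) by auto
    then show "finite (blk x)" "blk x \<inter> S \<subseteq> {x}" using fin separated x by blast+
  qed (use E S(1) in simp)
  have "\<not> inj_on (\<lambda>x. blk x \<inter> E) S"
  proof
    assume "inj_on (\<lambda>x. blk x \<inter> E) S"
    then have "card S \<le> card (Pow E)"
      using card_inj_on_le[of _ S "Pow E"] E by blast
    then show False using S(3) E by (simp add: card_Pow)
  qed
  then obtain a b where ab: "a \<in> S" "b \<in> S" "a \<noteq> b" "blk a \<inter> E = blk b \<inter> E"
    unfolding inj_on_def by blast
  have blk_ab: "blk a \<in> P" "a \<in> blk a" "blk b \<in> P" "b \<in> blk b"
    using blk ab(1,2) S(2) by auto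
  then have "blk a \<noteq> blk b" using separated ab(1-3) by blast
  then have "blk a \<inter> blk b = {}" using P blk_ab unfolding is_partition_def by blast
  then have "blk a \<inter> E = {}" "blk b \<inter> E = {}" using ab(4) by blast+
  then have "blk a = {a}" "blk b = {b}"
    using blk_subset[OF ab(1)] blk_subset[OF ab(2)] blk_ab by blast+
  then show ?thesis
    using partition_transpose_invariant_singletons[OF P, of a b] blk_ab ab(1-3) by auto
qed

lemma fm_supports_transpose:
  assumes supp: "fm_supports E f" and "c \<notin> E" "d \<notin> E" and s: "s \<in> seq_inj UNIV"
  shows "f (map (transpose c d) s) = (\<lambda>B. transpose c d ` B) ` f s"
proof -
  have "fixing_perm E (transpose c d)"
    using assms(2,3) unfolding fixing_perm_def by (auto simp: transpose_def)
  then show ?thesis using supp s unfolding fm_supports_def by blast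
qed

theorem theorem3p1:
  shows "\<not> (\<exists>E f. finite E \<and> fm_supports E f \<and>
            f ` seq_inj (UNIV::nat set) \<subseteq> Part_fin UNIV \<and>
            inj_on f (seq_inj (UNIV::nat set)))"
proof
  assume "\<exists>E f. finite E \<and> fm_supports E f \<and>
            f ` seq_inj (UNIV::nat set) \<subseteq> Part_fin UNIV \<and>
            inj_on f (seq_inj (UNIV::nat set))"
  then obtain E f where E: "finite E" and supp: "fm_supports E f"
    and part: "f ` seq_inj (UNIV::nat set) \<subseteq> Part_fin UNIV"
    and inj: "inj_on f (seq_inj (UNIV::nat set))" by blast
  obtain S where S: "S \<subseteq> - E" "finite S" "card S = 2 ^ card E + 1"
    using infinite_arbitrarily_large[of "- E"] E by auto
  define s where "s = sorted_list_of_set S"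
  have s: "s \<in> seq_inj UNIV" "set s = S" using S by (simp_all add: s_def seq_inj_def)
  have "\<exists>a\<in>S. \<exists>b\<in>S. a \<noteq> b \<and> (\<lambda>C. transpose a b ` C) ` f s = f s"
  proof (rule partition_transpose_invariant_pigeonhole[OF infinite_UNIV_nat _ _ E])
    show "is_partition UNIV (f s)" "\<forall>B\<in>f s. finite B"
      using part s(1) unfolding Part_fin_def by auto
    show "(\<lambda>C. transpose c d ` C) ` f s = f s" if "c \<notin> E \<union> S" "d \<notin> E \<union> S" for c d
    proof -
      have "map (transpose c d) s = s" by (rule map_idI) (use that s(2) in \<open>auto simp: transpose_def\<close>)
      then show ?thesis using fm_supports_transpose[OF supp _ _ s(1), of c d] that by simp
    qed
  qed (use S in auto)
  then obtain a b where ab: "a \<in> S" "a \<noteq> b" "(\<lambda>C. transpose a b ` C) ` f s = f s"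
    and "b \<in> S" by blast
  then have "f (map (transpose a b) s) = f s"
    using fm_supports_transpose[OF supp _ _ s(1), of a b] S by auto
  moreover have "map (transpose a b) s \<in> seq_inj UNIV"
    using s(1) by (simp add: seq_inj_def distinct_map)
  ultimately have "map (transpose a b) s = s" using inj s(1) unfolding inj_on_def by blast
  then have "map (transpose a b) s = map id s" by simp
  then have "transpose a b a = a" using ab(1) s(2) by (simp only: map_eq_conv id_apply)
  then show False using ab(2) by simp
qed

end
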